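(* Let $y_1,\dots,y_l$ and $z_1,\dots,z_m$ be sequences of distinct points in $D$. Then $$(\hat e(y_1)\cdots\hat e(y_l)\mathbf 1,\ \hat e(z_1)\cdots\hat e(z_m)\mathbf 1)=\begin{cases}0&\text{if }l\ne m,\\[4pt] \displaystyle\sum_\sigma\frac1{(1-u(z_1)\overline{u}(y_{\sigma(1)}))^2}\cdots\frac1{(1-u(z_l)\overline u(y_{\sigma(l)}))^2}&\text{if }l=m,\end{cases}$$ where the sum runs over all permutations $\sigma$ of $(1,\dots,l)$.
   Context: $\mathbb P$ is a complex projective line with canonical bundle $K$, $C:\mathbb P\to\mathbb P$ is the antiholomorphic involution which in a coordinate $u$ is $u(C(z))=1/\overline{u(z)}$. $D=\{|u|<1\}$, $D'=C(D)$ is the complement of its closure. ${}_D\mathbf K$ is the space of meromorphic 1-forms on $\mathbb P$ with all residues zero and all poles in $D$; ${}_D\mathbf W=S^*({}_D\mathbf K)$, with vacuum $\mathbf 1=1\in\mathbb C$. For $z\in D$, $\hat e(z):{}_D\mathbf W\to{}_D\mathbf W$ is multiplication by $-\frac{du}{(u-u(z))^2}$. For $z\notin D$, $z\neq$ the pole of $u$, $\hat i(z):{}_D\mathbf W\to{}_D\mathbf W$ is the derivation with $\hat i(z)\mathbf 1=0$ and $\hat i(z)(a\,du)=-a(z)$ for $a\,du\in{}_D\mathbf K$. $(\cdot,\cdot)$ is the hermitian form on ${}_D\mathbf W$ (antilinear in the first argument, linear in the second), compatible with derivatives of the fields in $z$, characterised by $(\mathbf 1,\mathbf 1)=1$, $u(z)^2(\chi,\hat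 e(z)\psi)=(\hat i(C(z))\chi,\psi)$ for $z\in D$ (at $u(z)=0$ by continuity: $(\chi,\hat e(z)\psi)$ is holomorphic in $z\in D$), and $u(z')^2(\chi,\hat i(z')\psi)=(\hat e(C(z'))\chi,\psi)$ for $z'\in D'$, for all $\chi,\psi\in{}_D\mathbf W$. $\overline u(y)$ denotes $\overline{u(y)}$. *)

theory Defs
  imports
    "HOL-Complex_Analysis.Complex_Analysis"
    "HOL-Library.Poly_Mapping"
    "HOL-Library.Multiset"
    "HOL-Combinatorics.Permutations"
begin

section \<open>The projective line and its meromorphic 1-forms\<close>

text \<open>The projective line is identified with the complex plane and a point at infinity by means of
  the coordinate \<open>u\<close>, here called \<open>coord\<close>; \<open>Infty\<close> is the pole of \<open>u\<close>, where \<open>coord\<close> is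
  unspecified.\<close>

datatype proj_line = Pt (coord: complex) | Infty

fun Cinv :: "proj_line \<Rightarrow> proj_line" where
  "Cinv (Pt \<zeta>) = (if \<zeta> = 0 then Infty else Pt (1 / cnj \<zeta>))"
| "Cinv Infty = Pt 0"

definition discD :: "proj_line set" where
  "discD = Pt ` {\<zeta>. cmod \<zeta> < 1}"

definition discD' :: "proj_line set" where
  "discD' = Cinv ` discD"

text \<open>A meromorphic 1-form \<open>a du\<close> is represented by its coefficient function \<open>a\<close>, in the normal
  form of \<open>nicely_meromorphic_on\<close> (no removable singularities, value 0 at the poles), so that equal
  forms are equal functions.  In the coordinate \<open>w = 1/u\<close> around infinity,
  \<open>a du = - a(1/w) / w\<^sup>2 dw\<close>.\<close>

definition coeff_at_infinity :: "(complex \<Rightarrow> complex) \<Rightarrow> complex \<Rightarrow> complex" where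
  "coeff_at_infinity a = (\<lambda>w. - a (1 / w) / w\<^sup>2)"

definition meromorphic_form :: "(complex \<Rightarrow> complex) \<Rightarrow> bool" where
  "meromorphic_form a \<longleftrightarrow>
     a nicely_meromorphic_on UNIV \<and> coeff_at_infinity a meromorphic_on {0}"

fun form_pole :: "(complex \<Rightarrow> complex) \<Rightarrow> proj_line \<Rightarrow> bool" where
  "form_pole a (Pt \<zeta>) \<longleftrightarrow> is_pole a \<zeta>"
| "form_pole a Infty \<longleftrightarrow> is_pole (coeff_at_infinity a) 0"

fun form_residue :: "(complex \<Rightarrow> complex) \<Rightarrow> proj_line \<Rightarrow> complex" where
  "form_residue a (Pt \<zeta>) = residue a \<zeta>"
| "form_residue a Infty = residue (coeff_at_infinity a) 0"

definition K_forms :: "(complex \<Rightarrow> complex) set" where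
  "K_forms = {a. meromorphic_form a \<and> (\<forall>p. form_residue a p = 0) \<and>
                 (\<forall>p. form_pole a p \<longrightarrow> p \<in> discD)}"

lemma Pt_in_discD_iff [simp]: "Pt \<zeta> \<in> discD \<longleftrightarrow> cmod \<zeta> < 1"
  by (auto simp: discD_def)

lemma Infty_notin_discD [simp]: "Infty \<notin> discD"
  by (auto simp: discD_def)

lemma K_forms_residue: "a \<in> K_forms \<Longrightarrow> form_residue a p = 0"
  by (simp add: K_forms_def)

lemma K_forms_pole: "a \<in> K_forms \<Longrightarrow> form_pole a p \<Longrightarrow> p \<in> discD"
  by (simp add: K_forms_def)

lemma K_forms_analytic:
  assumes "a \<in> K_forms" "cmod z \<ge> 1"
  shows "a analytic_on {z}"
proof -
  have "\<not> is_pole a z"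
    using K_forms_pole[OF assms(1), of "Pt z"] assms(2) by auto
  then show ?thesis
    using assms by (auto simp: K_forms_def meromorphic_form_def intro: nicely_meromorphic_on_imp_analytic_at)
qed

lemma not_pole_add:
  assumes "f meromorphic_on {z}" "g meromorphic_on {z}" "\<not> is_pole f z" "\<not> is_pole g z"
  shows "\<not> is_pole (\<lambda>w. f w + g w) z"
proof -
  obtain c d where "f \<midarrow>z\<rightarrow> c" "g \<midarrow>z\<rightarrow> d"
    using assms by (auto simp: meromorphic_at_iff not_essential_def)
  then have "(\<lambda>w. f w + g w) \<midarrow>z\<rightarrow> c + d"
    by (intro tendsto_add)
  then show ?thesis
    using not_tendsto_and_filterlim_at_infinity[of "at z"] by (auto simp: is_pole_def)
qed

lemma residue_meromorphic_add:
  assumes "f meromorphic_on {z}" "g meromorphic_on {z}"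
  shows "residue (\<lambda>w. f w + g w) z = residue f z + residue g z"
proof -
  obtain F G where FG: "(\<lambda>w. f (z + w)) has_laurent_expansion F"
      "(\<lambda>w. g (z + w)) has_laurent_expansion G"
    using assms by (auto simp: meromorphic_on_def)
  then have "(\<lambda>w. f (z + w) + g (z + w)) has_laurent_expansion F + G"
    by (intro laurent_expansion_intros)
  with FG show ?thesis
    using has_laurent_expansion_residue[of "\<lambda>w. f w + g w" z "F + G"]
    by (simp add: has_laurent_expansion_residue)
qed

lemma residue_meromorphic_cmult:
  assumes "f meromorphic_on {z}"
  shows "residue (\<lambda>w. c * f w) z = c * residue f z"
proof -
  obtain F where F: "(\<lambda>w. f (z + w)) has_laurent_expansion F"
    using assms by (auto simp: meromorphic_on_def)
  then have "(\<lambda>w. c * f (z + w)) has_laurent_expansion fls_const c * F"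
    by (intro laurent_expansion_intros)
  with F show ?thesis
    using has_laurent_expansion_residue[of "\<lambda>w. c * f w" z "fls_const c * F"]
    by (simp add: has_laurent_expansion_residue)
qed

lemma K_forms_meromorphic: "a \<in> K_forms \<Longrightarrow> a meromorphic_on S"
  by (rule meromorphic_on_subset[of _ UNIV])
     (auto simp: K_forms_def meromorphic_form_def nicely_meromorphic_on_def)

lemma K_forms_add:
  assumes a: "a \<in> K_forms" and b: "b \<in> K_forms"
  shows "remove_sings (\<lambda>w. a w + b w) \<in> K_forms"
proof -
  let ?s = "\<lambda>w. a w + b w" and ?c = coeff_at_infinity
  have mer: "?s meromorphic_on {z}" for z
    using K_forms_meromorphic[OF a] K_forms_meromorphic[OF b] by (intro meromorphic_intros)
  have iso: "isolated_singularity_at ?s z" for z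
    using mer by (simp add: meromorphic_at_iff)
  have out: "remove_sings ?s z = ?s z" if "cmod z \<ge> 1" for z
    using that by (intro remove_sings_at_analytic analytic_on_add K_forms_analytic a b)
  have "eventually (\<lambda>w::complex. w \<in> ball 0 1 - {0}) (at 0)"
    by (intro eventually_at_in_open) auto
  then have ev: "eventually (\<lambda>w. ?c (remove_sings ?s) w = ?c a w + ?c b w) (at 0)"
  proof eventually_elim
    case (elim w)
    then have "cmod (1 / w) \<ge> 1"
      by (auto simp: norm_divide)
    from out[OF this] show ?case
      by (simp only: coeff_at_infinity_def minus_add_distrib add_divide_distrib)
  qed
  have inf: "?c a meromorphic_on {0}" "?c b meromorphic_on {0}"
    using a b by (auto simp: K_forms_def meromorphic_form_def)
  have np: "\<not> is_pole (?c a) 0" "\<not> is_pole (?c b) 0"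
    using K_forms_pole[OF a, of Infty] K_forms_pole[OF b, of Infty] by auto
  have "remove_sings ?s nicely_meromorphic_on UNIV"
    by (intro remove_sings_nicely_meromorphic meromorphic_on_add K_forms_meromorphic a b)
  moreover have "?c (remove_sings ?s) meromorphic_on {0}"
    using meromorphic_on_add[OF inf] ev
    by (subst meromorphic_on_cong[of "{0}" _ "\<lambda>w. ?c a w + ?c b w", OF _ refl]) simp_all
  moreover have "form_residue (remove_sings ?s) p = 0" for p
  proof (cases p)
    case (Pt \<zeta>)
    then show ?thesis
      using K_forms_residue[OF a, of "Pt \<zeta>"] K_forms_residue[OF b, of "Pt \<zeta>"] iso
        residue_meromorphic_add[OF K_forms_meromorphic[OF a] K_forms_meromorphic[OF b], of \<zeta>]
      by simp
  next
    case Infty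
    then show ?thesis
      using K_forms_residue[OF a, of Infty] K_forms_residue[OF b, of Infty]
        residue_meromorphic_add[OF inf] residue_cong[OF ev refl]
      by simp
  qed
  moreover have "p \<in> discD" if "form_pole (remove_sings ?s) p" for p
  proof (cases p)
    case (Pt \<zeta>)
    show ?thesis
    proof (rule ccontr)
      assume "p \<notin> discD"
      with Pt have "\<not> is_pole a \<zeta>" "\<not> is_pole b \<zeta>"
        using K_forms_pole[OF a, of "Pt \<zeta>"] K_forms_pole[OF b, of "Pt \<zeta>"] by auto
      with that Pt show False
        using not_pole_add[OF K_forms_meromorphic[OF a] K_forms_meromorphic[OF b], of \<zeta>] iso by simp
    qed
  next
    case Infty
    then show ?thesis
      using that not_pole_add[OF inf np] is_pole_cong[OF ev refl] by simp
  qed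
  ultimately show ?thesis
    by (simp add: K_forms_def meromorphic_form_def)
qed

lemma K_forms_scale:
  assumes a: "a \<in> K_forms"
  shows "(\<lambda>w. c * a w) \<in> K_forms"
proof -
  let ?s = "\<lambda>w. c * a w" and ?c = coeff_at_infinity
  have eq: "?c ?s = (\<lambda>w. c * ?c a w)"
    by (simp add: coeff_at_infinity_def)
  have inf: "?c a meromorphic_on {0}"
    using a by (auto simp: K_forms_def meromorphic_form_def)
  have pole: "is_pole f z" if p: "is_pole (\<lambda>w. c * f w) z" and m: "f meromorphic_on {z}" for f z
  proof (rule ccontr)
    assume "\<not> is_pole f z"
    then obtain d where "f \<midarrow>z\<rightarrow> d"
      using m by (auto simp: meromorphic_at_iff not_essential_def)
    then have "(\<lambda>w. c * f w) \<midarrow>z\<rightarrow> c * d"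
      by (intro tendsto_mult tendsto_const)
    then show False
      using p not_tendsto_and_filterlim_at_infinity[of "at z"] by (auto simp: is_pole_def)
  qed
  have "form_residue ?s p = 0" for p
    using K_forms_residue[OF a, of p] residue_meromorphic_cmult[OF K_forms_meromorphic[OF a]]
      residue_meromorphic_cmult[OF inf]
    by (cases p) (simp_all add: eq)
  moreover have "p \<in> discD" if "form_pole ?s p" for p
  proof -
    have "form_pole a p"
      using that pole[OF _ K_forms_meromorphic[OF a]] pole[OF _ inf]
      by (cases p) (auto simp: eq)
    with a show ?thesis by (rule K_forms_pole)
  qed
  moreover have "?s nicely_meromorphic_on UNIV"
    using a by (intro nicely_meromorphic_on_cmult_left) (simp add: K_forms_def meromorphic_form_def)
  moreover have "?c ?s meromorphic_on {0}"
    unfolding eq by (intro meromorphic_on_mult meromorphic_on_const inf)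
  ultimately show ?thesis
    by (simp add: K_forms_def meromorphic_form_def)
qed

lemma K_forms_zero: "(\<lambda>_. 0) \<in> K_forms"
proof -
  have c: "coeff_at_infinity (\<lambda>_. 0) = (\<lambda>_. 0)"
    by (simp add: coeff_at_infinity_def)
  have np: "\<not> is_pole (\<lambda>_. 0 :: complex) z" for z :: complex
    using not_tendsto_and_filterlim_at_infinity[of "at z", OF _ tendsto_const] by (auto simp: is_pole_def)
  have "form_residue (\<lambda>_. 0) p = 0" "\<not> form_pole (\<lambda>_. 0) p" for p
    by (cases p; simp add: c residue_const np)+
  then show ?thesis
    by (auto simp: K_forms_def meromorphic_form_def c)
qed


text \<open>The \<open>k\<close>-th derivative of \<open>-1/(w - \<zeta>)\<^sup>2\<close> with respect to \<open>\<zeta>\<close>, see \<open>dipole_coeff_0\<close> and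
  \<open>dipole_coeff_deriv\<close>.\<close>

definition dipole_coeff :: "nat \<Rightarrow> complex \<Rightarrow> complex \<Rightarrow> complex" where
  "dipole_coeff k \<zeta> w = - fact (Suc k) / (w - \<zeta>) ^ (k + 2)"

lemma dipole_coeff_0: "dipole_coeff 0 \<zeta> w = - 1 / (w - \<zeta>)\<^sup>2"
  by (simp add: dipole_coeff_def power2_eq_square)

lemma dipole_coeff_deriv:
  assumes "w \<noteq> \<zeta>"
  shows "((\<lambda>\<zeta>. dipole_coeff k \<zeta> w) has_field_derivative dipole_coeff (Suc k) \<zeta> w) (at \<zeta>)"
proof -
  let ?x = "w - \<zeta>"
  have nz: "?x \<noteq> 0"
    using assms by simp
  have eq: "fact (Suc k) * (of_nat (k + 2) * ?x ^ (k + 1)) / (?x ^ (k + 2))\<^sup>2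
      = fact (k + 2) / ?x ^ (k + 3)"
  proof -
    have "x ^ (k + 1) / (x ^ (k + 2))\<^sup>2 = 1 / x ^ (k + 3)" if "x \<noteq> 0" for x :: complex
      using that by (simp add: divide_simps power2_eq_square eval_nat_numeral)
    from this[OF nz] show ?thesis
      by (simp add: eval_nat_numeral flip: times_divide_eq_right) (simp add: algebra_simps)
  qed
  have "((\<lambda>\<zeta>. - fact (Suc k) / (w - \<zeta>) ^ (k + 2)) has_field_derivative
          - (fact (Suc k) * (of_nat (k + 2) * ?x ^ (k + 1)) / (?x ^ (k + 2))\<^sup>2)) (at \<zeta>)"
    by (rule derivative_eq_intros refl | use nz in \<open>simp add: power2_eq_square\<close>)+
  then show ?thesis
    unfolding dipole_coeff_def eq by (simp add: eval_nat_numeral)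
qed

lemma dipole_coeff_in_K_forms:
  assumes "cmod \<zeta> < 1"
  shows "dipole_coeff k \<zeta> \<in> K_forms"
proof -
  let ?a = "dipole_coeff k \<zeta>" and ?c = coeff_at_infinity
  let ?g = "\<lambda>w. fact (Suc k) * w ^ k / (1 - \<zeta> * w) ^ (k + 2)"
  have pole: "is_pole ?a \<zeta>"
    unfolding dipole_coeff_def by (rule is_pole_basic[of _ UNIV]) (auto simp del: fact_Suc)
  have ana: "?a analytic_on {z}" if "z \<noteq> \<zeta>" for z
    unfolding dipole_coeff_def using that by (intro analytic_intros) auto
  have mer: "?a meromorphic_on UNIV"
    unfolding dipole_coeff_def by (intro meromorphic_intros)
  have ginf: "?g analytic_on {0}"
    by (intro analytic_intros) auto
  have "eventually (\<lambda>w::complex. w \<noteq> 0) (at 0)"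
    by (rule eventually_neq_at_within)
  then have ev: "eventually (\<lambda>w. ?c ?a w = ?g w) (at 0)"
  proof eventually_elim
    case (elim w)
    have eq: "1 / w - \<zeta> = (1 - \<zeta> * w) / w"
      using elim by (simp add: field_simps)
    show ?case
      using elim by (simp add: coeff_at_infinity_def dipole_coeff_def eq power_divide power2_eq_square)
  qed
  have "form_residue ?a p = 0" for p
  proof (cases p)
    case (Pt z)
    show ?thesis
    proof (cases "z = \<zeta>")
      case True
      have "residue (\<lambda>w. - fact (Suc k) / (w - \<zeta>) ^ Suc (k + 1)) \<zeta>
          = (deriv ^^ (k + 1)) (\<lambda>_. - fact (Suc k)) \<zeta> / fact (k + 1)"
        by (rule residue_holomorphic_over_power[of UNIV]) auto
      moreover have "?a = (\<lambda>w. - fact (Suc k) / (w - \<zeta>) ^ Suc (k + 1))"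
        by (simp add: dipole_coeff_def fun_eq_iff)
      ultimately show ?thesis
        using Pt True by simp
    next
      case False
      then show ?thesis
        using Pt ana[of z] by (auto simp: analytic_at intro: residue_holo)
    qed
  next
    case Infty
    then show ?thesis
      using residue_cong[OF ev refl] ginf by (auto simp: analytic_at intro: residue_holo)
  qed
  moreover have "p \<in> discD" if "form_pole ?a p" for p
  proof (cases p)
    case (Pt z)
    then show ?thesis
      using that ana[of z] analytic_at_imp_no_pole[of ?a z] assms by (cases "z = \<zeta>") auto
  next
    case Infty
    then show ?thesis
      using that is_pole_cong[OF ev refl] analytic_at_imp_no_pole[OF ginf] by simp
  qed
  moreover have "?a nicely_meromorphic_on UNIV"
    unfolding nicely_meromorphic_on_def
  proof (intro conjI mer ballI)
    fix z
    show "is_pole ?a z \<and> ?a z = 0 \<or> ?a \<midarrow>z\<rightarrow> ?a z"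
    proof (cases "z = \<zeta>")
      case True
      then show ?thesis
        using pole by (simp add: dipole_coeff_def)
    next
      case False
      then show ?thesis
        using analytic_at_imp_isCont[OF ana] by (simp add: isCont_def)
    qed
  qed
  moreover have "?c ?a meromorphic_on {0}"
    using analytic_on_imp_meromorphic_on[OF ginf] ev
    by (subst meromorphic_on_cong[of "{0}" _ ?g, OF _ refl]) simp_all
  ultimately show ?thesis
    by (simp add: K_forms_def meromorphic_form_def)
qed

lemma remove_sings_K_forms:
  assumes "a \<in> K_forms"
  shows "remove_sings a = a"
proof
  fix z
  have "is_pole a z \<and> a z = 0 \<or> a \<midarrow>z\<rightarrow> a z"
    using assms by (simp add: K_forms_def meromorphic_form_def nicely_meromorphic_on_def)
  then show "remove_sings a z = a z"
    using remove_sings_at_pole[of a z] remove_sings_eqI[of a "a z" z] by auto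
qed

lemma remove_sings_K_forms_add:
  assumes "a \<in> K_forms" "b \<in> K_forms"
  shows "eventually (\<lambda>w. remove_sings (\<lambda>w. a w + b w) w = a w + b w) (at z)"
proof -
  have "(\<lambda>w. a w + b w) meromorphic_on {z}"
    by (intro meromorphic_on_add K_forms_meromorphic assms)
  then show ?thesis
    by (intro eventually_remove_sings_eq_at) (simp add: meromorphic_at_iff)
qed

typedef kform = K_forms
  morphisms coeff Abs_kform
  using K_forms_zero by blast

setup_lifting type_definition_kform

instantiation kform :: ab_group_add
begin

lift_definition zero_kform :: kform is "\<lambda>_. 0"
  by (rule K_forms_zero)

lift_definition plus_kform :: "kform \<Rightarrow> kform \<Rightarrow> kform" is "\<lambda>a b. remove_sings (\<lambda>w. a w + b w)"
  by (rule K_forms_add)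

lift_definition uminus_kform :: "kform \<Rightarrow> kform" is "\<lambda>a w. - a w"
  using K_forms_scale[of _ "- 1"] by simp

definition minus_kform :: "kform \<Rightarrow> kform \<Rightarrow> kform" where
  "minus_kform a b = a + - b"

instance
proof
  fix a b c :: kform
  show "a + b + c = a + (b + c)"
  proof (transfer, rule ext)
    fix a b c :: "complex \<Rightarrow> complex" and z
    assume abc: "a \<in> K_forms" "b \<in> K_forms" "c \<in> K_forms"
    have "eventually (\<lambda>w. remove_sings (\<lambda>w. a w + b w) w + c w
        = a w + remove_sings (\<lambda>w. b w + c w) w) (at z)"
      using remove_sings_K_forms_add[OF abc(1,2)] remove_sings_K_forms_add[OF abc(2,3)]
      by eventually_elim (simp add: add.assoc)
    then show "remove_sings (\<lambda>w. remove_sings (\<lambda>w. a w + b w) w + c w) z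
        = remove_sings (\<lambda>w. a w + remove_sings (\<lambda>w. b w + c w) w) z"
      by (rule remove_sings_cong) simp
  qed
  show "a + b = b + a"
    by transfer (simp add: add.commute)
  show "0 + a = a"
    by transfer (simp add: remove_sings_K_forms)
  show "- a + a = 0"
    by transfer (simp add: remove_sings_K_forms[OF K_forms_zero])
  show "a - b = a + - b"
    by (rule minus_kform_def)
qed

end

lift_definition scaleK :: "complex \<Rightarrow> kform \<Rightarrow> kform" is "\<lambda>c a w. c * a w"
  by (rule K_forms_scale)

interpretation K: vector_space scaleK
proof
  fix c d :: complex and a b :: kform
  show "scaleK c (a + b) = scaleK c a + scaleK c b"
  proof (transfer, rule ext)
    fix c :: complex and a b :: "complex \<Rightarrow> complex" and z
    assume ab: "a \<in> K_forms" "b \<in> K_forms"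
    have "eventually (\<lambda>w. c * remove_sings (\<lambda>w. a w + b w) w = c * a w + c * b w) (at z)"
      using remove_sings_K_forms_add[OF ab] by eventually_elim (simp add: distrib_left)
    then have "remove_sings (\<lambda>w. c * remove_sings (\<lambda>w. a w + b w) w) z
        = remove_sings (\<lambda>w. c * a w + c * b w) z"
      by (rule remove_sings_cong) simp
    then show "c * remove_sings (\<lambda>w. a w + b w) z = remove_sings (\<lambda>w. c * a w + c * b w) z"
      by (simp add: remove_sings_K_forms[OF K_forms_scale[OF K_forms_add[OF ab]]])
  qed
  show "scaleK (c + d) a = scaleK c a + scaleK d a"
  proof transfer
    fix c d :: complex and a
    assume "a \<in> K_forms"
    from remove_sings_K_forms[OF K_forms_scale[OF this]]
    show "(\<lambda>w. (c + d) * a w) = remove_sings (\<lambda>w. c * a w + d * a w)"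
      by (simp flip: distrib_right)
  qed
  show "scaleK c (scaleK d a) = scaleK (c * d) a"
    by transfer (simp add: mult.assoc)
  show "scaleK 1 a = a"
    by transfer simp
qed

lemma coeff_add:
  assumes "cmod z \<ge> 1"
  shows "coeff (a + b) z = coeff a z + coeff b z"
  using assms by transfer (intro remove_sings_at_analytic analytic_on_add K_forms_analytic)

lemma coeff_scale: "coeff (scaleK c a) z = c * coeff a z"
  by transfer simp

section \<open>The symmetric algebra\<close>

text \<open>The symmetric algebra is the polynomial algebra on the underlying set of the vector space,
  modulo the ideal generated by the relations \<open>[a + b] = [a] + [b]\<close> and \<open>[c a] = c [a]\<close>.\<close>

type_synonym kpoly = "kform multiset \<Rightarrow>\<^sub>0 complex"

definition const_poly :: "complex \<Rightarrow> kpoly" where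
  "const_poly c = Poly_Mapping.single {#} c"

definition var_poly :: "kform \<Rightarrow> kpoly" where
  "var_poly a = Poly_Mapping.single {#a#} 1"

lemma module_kpoly: "module ((*) :: kpoly \<Rightarrow> kpoly \<Rightarrow> kpoly)"
  by unfold_locales (simp_all add: algebra_simps)

definition sym_relations :: "kpoly set" where
  "sym_relations =
     {var_poly (a + b) - (var_poly a + var_poly b) | a b. True} \<union>
     {var_poly (scaleK c a) - const_poly c * var_poly a | c a. True}"

definition sym_ideal :: "kpoly set" where
  "sym_ideal = module.span (*) sym_relations"

lemma sym_ideal_add: "p \<in> sym_ideal \<Longrightarrow> q \<in> sym_ideal \<Longrightarrow> p + q \<in> sym_ideal"
  unfolding sym_ideal_def by (rule module.span_add[OF module_kpoly])

lemma sym_ideal_mult: "p \<in> sym_ideal \<Longrightarrow> q * p \<in> sym_ideal"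
  unfolding sym_ideal_def by (rule module.span_scale[OF module_kpoly])

lemma sym_ideal_zero: "0 \<in> sym_ideal"
  unfolding sym_ideal_def by (rule module.span_zero[OF module_kpoly])

lemma sym_ideal_uminus: "p \<in> sym_ideal \<Longrightarrow> - p \<in> sym_ideal"
  unfolding sym_ideal_def by (rule module.span_neg[OF module_kpoly])

lemma sym_ideal_diff: "p \<in> sym_ideal \<Longrightarrow> q \<in> sym_ideal \<Longrightarrow> p - q \<in> sym_ideal"
  unfolding sym_ideal_def by (rule module.span_diff[OF module_kpoly])

quotient_type W_space = kpoly / "\<lambda>p q. p - q \<in> sym_ideal"
proof (rule equivpI)
  show "reflp (\<lambda>p q. p - q \<in> sym_ideal)"
    by (rule reflpI) (simp add: sym_ideal_zero)
  show "symp (\<lambda>p q. p - q \<in> sym_ideal)"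
    by (rule sympI) (use sym_ideal_uminus in fastforce)
  show "transp (\<lambda>p q. p - q \<in> sym_ideal)"
    by (rule transpI) (use sym_ideal_add in fastforce)
qed

lemma lookup_mult_zero:
  fixes p q :: kpoly
  shows "Poly_Mapping.lookup (p * q) {#} = Poly_Mapping.lookup p {#} * Poly_Mapping.lookup q {#}"
proof -
  have "(Poly_Mapping.lookup q y when {#} = x + y)
      = ((Poly_Mapping.lookup q {#} when x = {#}) when y = {#})" for x y
    by (auto simp: when_def)
  then have "Poly_Mapping.lookup (p * q) {#}
      = Sum_any (\<lambda>x. Poly_Mapping.lookup p x * (Poly_Mapping.lookup q {#} when x = {#}))"
    by (simp add: lookup_mult)
  then show ?thesis
    by (simp add: mult_when)
qed

lemma sym_ideal_induct [consumes 1, case_names zero step]: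
  assumes "p \<in> sym_ideal" "P 0"
    and "\<And>q r p. r \<in> sym_relations \<Longrightarrow> P p \<Longrightarrow> P (q * r + p)"
  shows "P p"
  using module.span_induct_alt[OF module_kpoly assms(1)[unfolded sym_ideal_def], of P] assms(2,3)
  by blast

lemma sym_ideal_lookup_zero: "p \<in> sym_ideal \<Longrightarrow> Poly_Mapping.lookup p {#} = 0"
proof (induction rule: sym_ideal_induct)
  case (step q r p)
  from step(1) have "Poly_Mapping.lookup r {#} = 0"
    unfolding sym_relations_def
    by (auto simp: var_poly_def lookup_add lookup_minus lookup_mult_zero lookup_single)
  with step(2) show ?case
    by (simp add: lookup_add lookup_mult_zero)
qed simp

instantiation W_space :: comm_ring_1
begin

lift_definition zero_W_space :: W_space is 0 .
lift_definition one_W_space :: W_space is 1 .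

lift_definition plus_W_space :: "W_space \<Rightarrow> W_space \<Rightarrow> W_space" is "(+)"
  by (drule (1) sym_ideal_add) (simp add: algebra_simps)

lift_definition minus_W_space :: "W_space \<Rightarrow> W_space \<Rightarrow> W_space" is "(-)"
  by (drule (1) sym_ideal_diff) (simp add: algebra_simps)

lift_definition uminus_W_space :: "W_space \<Rightarrow> W_space" is uminus
  by (drule sym_ideal_uminus) (simp add: algebra_simps)

lift_definition times_W_space :: "W_space \<Rightarrow> W_space \<Rightarrow> W_space" is "(*)"
proof -
  fix p p' q q' :: kpoly
  assume "p - p' \<in> sym_ideal" "q - q' \<in> sym_ideal"
  then have "q * (p - p') + p' * (q - q') \<in> sym_ideal"
    by (intro sym_ideal_add sym_ideal_mult)
  then show "p * q - p' * q' \<in> sym_ideal"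
    by (simp add: algebra_simps)
qed

instance
proof
  show "(0::W_space) \<noteq> 1"
  proof (transfer, rule notI)
    assume "(0::kpoly) - 1 \<in> sym_ideal"
    from sym_ideal_lookup_zero[OF this] show False
      by (simp add: lookup_minus lookup_one)
  qed
qed (transfer; simp add: algebra_simps sym_ideal_zero)+

end

lift_definition scaleW :: "complex \<Rightarrow> W_space \<Rightarrow> W_space" is "\<lambda>c p. const_poly c * p"
  by (drule sym_ideal_mult) (simp add: right_diff_distrib)

lemma const_poly_add: "const_poly (c + d) = const_poly c + const_poly d"
  by (simp add: const_poly_def single_add)

lemma const_poly_mult: "const_poly (c * d) = const_poly c * const_poly d"
  by (simp add: const_poly_def mult_single)

lemma const_poly_1 [simp]: "const_poly 1 = 1"
  by (simp add: const_poly_def)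

interpretation W: vector_space scaleW
  by unfold_locales (transfer; simp add: algebra_simps const_poly_add const_poly_mult sym_ideal_zero)+

lift_definition emb :: "kform \<Rightarrow> W_space" is var_poly .


text \<open>\<open>emb\<close> is the inclusion of the forms as the degree 1 part, and the scalars are embedded by
  \<open>c \<mapsto> scaleW c 1\<close>.  \<open>contraction \<phi>\<close> is the derivation extending the linear functional \<open>\<phi>\<close>.\<close>

definition derivation_W :: "(W_space \<Rightarrow> W_space) \<Rightarrow> bool" where
  "derivation_W \<delta> \<longleftrightarrow> Vector_Spaces.linear scaleW scaleW \<delta> \<and>
     (\<forall>\<xi> \<psi>. \<delta> (\<xi> * \<psi>) = \<delta> \<xi> * \<psi> + \<xi> * \<delta> \<psi>)"

definition contraction :: "(kform \<Rightarrow> complex) \<Rightarrow> W_space \<Rightarrow> W_space" where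
  "contraction \<phi> =
     (THE \<delta>. derivation_W \<delta> \<and> \<delta> 1 = 0 \<and> (\<forall>a. \<delta> (emb a) = scaleW (\<phi> a) 1))"

lemma kpoly_induct [case_names zero single_plus]:
  fixes p :: kpoly
  assumes "P 0" "\<And>m c p. P p \<Longrightarrow> P (Poly_Mapping.single m c + p)"
  shows "P p"
proof (induction p rule: update_induct)
  case const
  show ?case by (rule assms(1))
next
  case (update p m c)
  have "Poly_Mapping.update m c p = Poly_Mapping.single m c + p"
    using update(1) by (intro poly_mapping_eqI)
      (auto simp: lookup_update lookup_add lookup_single in_keys_iff when_def)
  with assms(2)[OF update(3)] show ?case
    by simp
qed

definition monomial_deriv :: "(kform \<Rightarrow> complex) \<Rightarrow> kform multiset \<Rightarrow> kpoly" where
  "monomial_deriv \<phi> m = (\<Sum>a\<in>#m. Poly_Mapping.single (m - {#a#}) (\<phi> a))"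

definition kpoly_deriv :: "(kform \<Rightarrow> complex) \<Rightarrow> kpoly \<Rightarrow> kpoly" where
  "kpoly_deriv \<phi> p =
     (\<Sum>m\<in>Poly_Mapping.keys p. const_poly (Poly_Mapping.lookup p m) * monomial_deriv \<phi> m)"

lemma monomial_deriv_add:
  "monomial_deriv \<phi> (m + n)
     = monomial_deriv \<phi> m * Poly_Mapping.single n 1 + Poly_Mapping.single m 1 * monomial_deriv \<phi> n"
proof -
  have "(\<Sum>a\<in>#m. Poly_Mapping.single (m + n - {#a#}) (\<phi> a))
      = (\<Sum>a\<in>#m. Poly_Mapping.single (m - {#a#}) (\<phi> a) * Poly_Mapping.single n 1)"
    by (intro arg_cong[of _ _ sum_mset] image_mset_cong) (simp add: mult_single)
  moreover have "(\<Sum>a\<in>#n. Poly_Mapping.single (m + n - {#a#}) (\<phi> a))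
      = (\<Sum>a\<in>#n. Poly_Mapping.single m 1 * Poly_Mapping.single (n - {#a#}) (\<phi> a))"
    by (intro arg_cong[of _ _ sum_mset] image_mset_cong) (simp add: mult_single)
  ultimately show ?thesis
    by (simp add: monomial_deriv_def sum_mset_distrib_left sum_mset_distrib_right)
qed

lemma kpoly_deriv_superset:
  assumes "finite A" "Poly_Mapping.keys p \<subseteq> A"
  shows "kpoly_deriv \<phi> p
    = (\<Sum>m\<in>A. const_poly (Poly_Mapping.lookup p m) * monomial_deriv \<phi> m)"
  unfolding kpoly_deriv_def
  using assms by (intro sum.mono_neutral_left) (auto simp: in_keys_iff const_poly_def)

lemma kpoly_deriv_add: "kpoly_deriv \<phi> (p + q) = kpoly_deriv \<phi> p + kpoly_deriv \<phi> q"
proof -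
  let ?A = "Poly_Mapping.keys p \<union> Poly_Mapping.keys q"
  have "kpoly_deriv \<phi> r
      = (\<Sum>m\<in>?A. const_poly (Poly_Mapping.lookup r m) * monomial_deriv \<phi> m)"
    if "Poly_Mapping.keys r \<subseteq> ?A" for r
    using that by (intro kpoly_deriv_superset) auto
  from this[of p] this[of q] this[of "p + q"] show ?thesis
    by (simp add: Poly_Mapping.keys_add lookup_add const_poly_add distrib_right sum.distrib)
qed

lemma kpoly_deriv_0 [simp]: "kpoly_deriv \<phi> 0 = 0"
  by (simp add: kpoly_deriv_def)

lemma kpoly_deriv_single: "kpoly_deriv \<phi> (Poly_Mapping.single m c) = const_poly c * monomial_deriv \<phi> m"
  using kpoly_deriv_superset[of "{m}" "Poly_Mapping.single m c" \<phi>] by simp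

lemma kpoly_deriv_mult: "kpoly_deriv \<phi> (p * q) = kpoly_deriv \<phi> p * q + p * kpoly_deriv \<phi> q"
proof (induction p rule: kpoly_induct)
  case (single_plus m c p)
  have "kpoly_deriv \<phi> (Poly_Mapping.single m c * q)
      = kpoly_deriv \<phi> (Poly_Mapping.single m c) * q + Poly_Mapping.single m c * kpoly_deriv \<phi> q"
  proof (induction q rule: kpoly_induct)
    case (single_plus n d q)
    have "kpoly_deriv \<phi> (Poly_Mapping.single m c * Poly_Mapping.single n d)
        = const_poly c * const_poly d * (monomial_deriv \<phi> m * Poly_Mapping.single n 1
            + Poly_Mapping.single m 1 * monomial_deriv \<phi> n)"
      by (simp add: mult_single kpoly_deriv_single monomial_deriv_add const_poly_mult)
    also have "\<dots> = const_poly c * monomial_deriv \<phi> m * (const_poly d * Poly_Mapping.single n 1)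
        + (const_poly c * Poly_Mapping.single m 1) * (const_poly d * monomial_deriv \<phi> n)"
      by (simp add: algebra_simps)
    also have "\<dots> = kpoly_deriv \<phi> (Poly_Mapping.single m c) * Poly_Mapping.single n d
        + Poly_Mapping.single m c * kpoly_deriv \<phi> (Poly_Mapping.single n d)"
      by (simp add: kpoly_deriv_single) (simp add: const_poly_def mult_single)
    finally show ?case
      using single_plus by (simp add: distrib_left distrib_right kpoly_deriv_add)
  qed simp
  then show ?case
    using single_plus by (simp add: distrib_left distrib_right kpoly_deriv_add)
qed simp

lemma kpoly_deriv_uminus: "kpoly_deriv \<phi> (- p) = - kpoly_deriv \<phi> p"
  using kpoly_deriv_add[of \<phi> p "- p"] by (simp add: eq_neg_iff_add_eq_0 add.commute)

lemma kpoly_deriv_diff: "kpoly_deriv \<phi> (p - q) = kpoly_deriv \<phi> p - kpoly_deriv \<phi> q"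
  using kpoly_deriv_add[of \<phi> p "- q"] by (simp add: kpoly_deriv_uminus)

lemma kpoly_deriv_const: "kpoly_deriv \<phi> (const_poly c) = 0"
  by (simp add: const_poly_def kpoly_deriv_single monomial_deriv_def)

lemma kpoly_deriv_var: "kpoly_deriv \<phi> (var_poly a) = const_poly (\<phi> a)"
  by (simp add: var_poly_def kpoly_deriv_single monomial_deriv_def) (simp add: const_poly_def)

lemma kpoly_deriv_sym_ideal:
  assumes "Vector_Spaces.linear scaleK (*) \<phi>" "p \<in> sym_ideal"
  shows "kpoly_deriv \<phi> p \<in> sym_ideal"
  using assms(2)
proof (induction rule: sym_ideal_induct)
  case (step q r p)
  interpret \<phi>: Vector_Spaces.linear scaleK "(*)" \<phi>
    by (rule assms(1))
  from step(1) have "kpoly_deriv \<phi> r = 0"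
    unfolding sym_relations_def
    by (auto simp: kpoly_deriv_diff kpoly_deriv_add kpoly_deriv_mult kpoly_deriv_const
        kpoly_deriv_var \<phi>.add \<phi>.scale const_poly_add const_poly_mult)
  moreover have "r \<in> sym_ideal"
    unfolding sym_ideal_def by (rule module.span_base[OF module_kpoly step(1)])
  ultimately show ?case
    using step(2) by (auto simp: kpoly_deriv_add kpoly_deriv_mult intro: sym_ideal_add sym_ideal_mult)
qed (simp add: sym_ideal_zero)

lemma W_space_abs_cases:
  obtains p where "\<psi> = abs_W_space p"
  using Quotient3_abs_rep[OF Quotient3_W_space, of \<psi>] by metis

lemma derivation_W_unique:
  assumes "derivation_W \<delta>" "derivation_W \<delta>'" "\<And>a. \<delta> (emb a) = \<delta>' (emb a)" "\<delta> 1 = \<delta>' 1"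
  shows "\<delta> = \<delta>'"
proof
  fix \<psi>
  interpret \<delta>: Vector_Spaces.linear scaleW scaleW \<delta>
    using assms(1) by (simp add: derivation_W_def)
  interpret \<delta>': Vector_Spaces.linear scaleW scaleW \<delta>'
    using assms(2) by (simp add: derivation_W_def)
  have mon: "\<delta> (abs_W_space (Poly_Mapping.single m 1)) = \<delta>' (abs_W_space (Poly_Mapping.single m 1))" for m
  proof (induction m)
    case empty
    show ?case
      using assms(4) by (simp add: one_W_space.abs_eq flip: single_one)
  next
    case (add a m)
    have "Poly_Mapping.single (add_mset a m) 1 = var_poly a * Poly_Mapping.single m 1"
      by (simp add: var_poly_def mult_single)
    then have "abs_W_space (Poly_Mapping.single (add_mset a m) 1)
        = emb a * abs_W_space (Poly_Mapping.single m 1)"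
      by (simp add: emb_def times_W_space.abs_eq)
    then show ?case
      using assms add by (simp add: derivation_W_def)
  qed
  have "\<delta> (abs_W_space p) = \<delta>' (abs_W_space p)" for p
  proof (induction p rule: kpoly_induct)
    case zero
    show ?case
      by (simp flip: zero_W_space.abs_eq)
  next
    case (single_plus m c p)
    have "Poly_Mapping.single m c = const_poly c * Poly_Mapping.single m 1"
      by (simp add: const_poly_def mult_single)
    then have "abs_W_space (Poly_Mapping.single m c + p)
        = scaleW c (abs_W_space (Poly_Mapping.single m 1)) + abs_W_space p"
      by (simp add: plus_W_space.abs_eq scaleW.abs_eq)
    then show ?case
      using single_plus mon by (simp add: \<delta>.add \<delta>.scale \<delta>'.add \<delta>'.scale)
  qed
  then show "\<delta> \<psi> = \<delta>' \<psi>"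
    by (metis W_space_abs_cases)
qed

lemma contraction:
  assumes "Vector_Spaces.linear scaleK (*) \<phi>"
  shows "derivation_W (contraction \<phi>)" "contraction \<phi> 1 = 0"
    "contraction \<phi> (emb a) = scaleW (\<phi> a) 1"
proof -
  define \<delta> where "\<delta> = (\<lambda>\<psi>. abs_W_space (kpoly_deriv \<phi> (rep_W_space \<psi>)))"
  have abs: "\<delta> (abs_W_space p) = abs_W_space (kpoly_deriv \<phi> p)" for p
  proof -
    have "rep_W_space (abs_W_space p) - p \<in> sym_ideal"
      using Quotient3_rep_abs[OF Quotient3_W_space] sym_ideal_zero by auto
    then have "kpoly_deriv \<phi> (rep_W_space (abs_W_space p)) - kpoly_deriv \<phi> p \<in> sym_ideal"
      using kpoly_deriv_sym_ideal[OF assms] by (simp flip: kpoly_deriv_diff)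
    then show ?thesis
      by (simp add: \<delta>_def W_space.abs_eq_iff)
  qed
  have "Vector_Spaces.linear scaleW scaleW \<delta>"
  proof (intro Vector_Spaces.linear_iff[THEN iffD2] conjI allI)
    show "vector_space scaleW" "vector_space scaleW"
      by (rule W.vector_space_axioms)+
    fix \<xi> \<psi> c
    obtain p q where "\<xi> = abs_W_space p" "\<psi> = abs_W_space q"
      by (metis W_space_abs_cases)
    then show "\<delta> (\<xi> + \<psi>) = \<delta> \<xi> + \<delta> \<psi>" "\<delta> (scaleW c \<xi>) = scaleW c (\<delta> \<xi>)"
      by (simp_all add: abs plus_W_space.abs_eq scaleW.abs_eq kpoly_deriv_add kpoly_deriv_mult
          kpoly_deriv_const)
  qed
  moreover have "\<delta> (\<xi> * \<psi>) = \<delta> \<xi> * \<psi> + \<xi> * \<delta> \<psi>" for \<xi> \<psi>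
  proof -
    obtain p q where "\<xi> = abs_W_space p" "\<psi> = abs_W_space q"
      by (metis W_space_abs_cases)
    then show ?thesis
      by (simp add: abs plus_W_space.abs_eq times_W_space.abs_eq kpoly_deriv_mult)
  qed
  ultimately have der: "derivation_W \<delta>"
    by (simp add: derivation_W_def)
  have one: "\<delta> 1 = 0"
    using kpoly_deriv_const[of \<phi> 1] by (simp add: abs one_W_space.abs_eq zero_W_space.abs_eq)
  have emb: "\<delta> (emb a) = scaleW (\<phi> a) 1" for a
    by (simp add: abs emb_def kpoly_deriv_var one_W_space.abs_eq scaleW.abs_eq)
  have "\<exists>!\<delta>. derivation_W \<delta> \<and> \<delta> 1 = 0 \<and> (\<forall>a. \<delta> (emb a) = scaleW (\<phi> a) 1)"
    using der one emb by (auto intro!: derivation_W_unique)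
  from theI'[OF this]
  show "derivation_W (contraction \<phi>)" "contraction \<phi> 1 = 0"
    "contraction \<phi> (emb a) = scaleW (\<phi> a) 1"
    by (simp_all add: contraction_def)
qed


section \<open>The fields and the hermitian form\<close>

text \<open>Division by zero gives the coefficient function below the value 0 at its pole, as the normal
  form requires; it belongs to \<open>K_forms\<close> for \<open>z \<in> discD\<close> by \<open>dipole_coeff_in_K_forms\<close>.
  The field \<open>ihat z\<close> is meaningful for \<open>z \<notin> discD\<close>, \<open>z \<noteq> Infty\<close>; the functional it contracts with
  is then linear (\<open>linear_coeff\<close>), so that the derivation exists uniquely (\<open>contraction\<close>).\<close>

definition ehat :: "proj_line \<Rightarrow> W_space \<Rightarrow> W_space" where
  "ehat z \<psi> = emb (Abs_kform (\<lambda>w. - 1 / (w - coord z)\<^sup>2)) * \<psi>"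

definition ihat :: "proj_line \<Rightarrow> W_space \<Rightarrow> W_space" where
  "ihat z = contraction (\<lambda>a. - coeff a (coord z))"

text \<open>The \<open>k\<close>-th derivatives of the two fields with respect to the coordinate of \<open>z\<close>
  (for \<open>k = 0\<close> the fields themselves).\<close>

definition ehat_deriv :: "nat \<Rightarrow> proj_line \<Rightarrow> W_space \<Rightarrow> W_space" where
  "ehat_deriv k z \<psi> = emb (Abs_kform (dipole_coeff k (coord z))) * \<psi>"

definition ihat_deriv :: "nat \<Rightarrow> proj_line \<Rightarrow> W_space \<Rightarrow> W_space" where
  "ihat_deriv k z = contraction (\<lambda>a. - (deriv ^^ k) (coeff a) (coord z))"

lemma ehat_deriv_0: "ehat_deriv 0 = ehat"
  by (simp add: fun_eq_iff ehat_deriv_def ehat_def dipole_coeff_0[abs_def])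

lemma ihat_deriv_0: "ihat_deriv 0 = ihat"
  by (simp add: fun_eq_iff ihat_deriv_def ihat_def)

lemma linear_coeff:
  assumes "cmod z \<ge> 1"
  shows "Vector_Spaces.linear scaleK (*) (\<lambda>a. - coeff a z)"
  using assms K.vector_space_axioms
  by (simp add: Vector_Spaces.linear_iff coeff_add coeff_scale vector_space_def algebra_simps)

lemma Pt_in_discD'_iff [simp]: "Pt \<zeta> \<in> discD' \<longleftrightarrow> cmod \<zeta> > 1"
proof
  assume "Pt \<zeta> \<in> discD'"
  then show "cmod \<zeta> > 1"
    by (auto simp: discD'_def discD_def norm_divide split: if_splits)
next
  assume "cmod \<zeta> > 1"
  then have "Pt \<zeta> = Cinv (Pt (1 / cnj \<zeta>))" "Pt (1 / cnj \<zeta>) \<in> discD"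
    by (auto simp: norm_divide divide_simps)
  then show "Pt \<zeta> \<in> discD'"
    unfolding discD'_def by (rule image_eqI)
qed

lemma Infty_in_discD' [simp]: "Infty \<in> discD'"
  unfolding discD'_def by (rule image_eqI[of _ _ "Pt 0"]) auto

text \<open>Antilinearity in the first argument follows from the two conditions.\<close>

definition hermitian_form :: "(W_space \<Rightarrow> W_space \<Rightarrow> complex) \<Rightarrow> bool" where
  "hermitian_form B \<longleftrightarrow>
     (\<forall>\<xi>. Vector_Spaces.linear scaleW (*) (B \<xi>)) \<and> (\<forall>\<xi> \<psi>. B \<psi> \<xi> = cnj (B \<xi> \<psi>))"

text \<open>The conditions that characterise the form on the space \<open>W_space\<close>.  The adjunction relations
  are stated where both sides make sense: at \<open>u(z) = 0\<close>, and at the pole of \<open>u\<close>, one of the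
  fields on the two sides is not defined.  The first relation extends to \<open>u(z) = 0\<close> by
  holomorphy of \<open>(\<xi>, e(z) \<psi>)\<close>.  Compatibility with derivatives says that the derivatives of the
  fields may be taken outside the form.\<close>

definition is_W_form :: "(W_space \<Rightarrow> W_space \<Rightarrow> complex) \<Rightarrow> bool" where
  "is_W_form B \<longleftrightarrow>
     hermitian_form B \<and>
     B 1 1 = 1 \<and>
     (\<forall>z\<in>discD. coord z \<noteq> 0 \<longrightarrow>
        (\<forall>\<xi> \<psi>. (coord z)\<^sup>2 * B \<xi> (ehat z \<psi>) = B (ihat (Cinv z) \<xi>) \<psi>)) \<and>
     (\<forall>\<xi> \<psi>. (\<lambda>\<zeta>. B \<xi> (ehat (Pt \<zeta>) \<psi>)) holomorphic_on {\<zeta>. cmod \<zeta> < 1}) \<and>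
     (\<forall>z\<in>discD' - {Infty}.
        (\<forall>\<xi> \<psi>. (coord z)\<^sup>2 * B \<xi> (ihat z \<psi>) = B (ehat (Cinv z) \<xi>) \<psi>)) \<and>
     (\<forall>z\<in>discD. \<forall>k \<xi> \<psi>.
        ((\<lambda>\<zeta>. B \<xi> (ehat_deriv k (Pt \<zeta>) \<psi>)) has_field_derivative B \<xi> (ehat_deriv (Suc k) z \<psi>))
          (at (coord z))) \<and>
     (\<forall>z\<in>discD' - {Infty}. \<forall>k \<xi> \<psi>.
        ((\<lambda>\<zeta>. B \<xi> (ihat_deriv k (Pt \<zeta>) \<psi>)) has_field_derivative B \<xi> (ihat_deriv (Suc k) z \<psi>))
          (at (coord z)))"

end

theory Submission
  imports Defs
begin

text \<open>
  This is Wick's theorem for the two fields.  The fields \<open>ehat\<close> are multiplications in a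
  commutative algebra, so a product of them applied to the vacuum is just a product of degree 1
  elements indexed by a finite set, in any order.  Moving one factor \<open>ehat z\<close> from the right of
  the form to the left turns it into the derivation \<open>ihat (Cinv z)\<close>, and a derivation removes the
  factors \<open>y i\<close> one at a time, each at the price of a scalar, which works out to
  \<open>1 / (1 - coord z * cnj (coord (y i)))\<^sup>2\<close> (\<open>form_contract\<close>).  This is the expansion of a
  permanent along a row.

  Iterating the expansion pairs every point on the right with a different point on the left, so
  that the value of the form is the sum over all bijections of the products of the scalars
  (\<open>form_eq_sum_bij\<close>).  If factors are left over on one side, the remaining form vanishes, in
  agreement with there being no bijection.

  The adjunction says nothing at \<open>coord z = 0\<close>.  There the row expansion follows because both of
  its sides are continuous in \<open>z\<close>.\<close>

section \<open>Derivations on products of degree 1 elements\<close>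

lemma scaleW_mult: "scaleW c (\<xi> * \<psi>) = scaleW c \<xi> * \<psi>"
  by transfer (simp add: mult.assoc sym_ideal_zero)

lemma ehat_eq_mult: "ehat z \<psi> = ehat z 1 * \<psi>"
  by (simp add: ehat_def)

lemma foldr_ehat_eq_prod:
  assumes "distinct xs"
  shows "foldr (\<lambda>i. ehat (y i)) xs 1 = (\<Prod>i\<in>set xs. ehat (y i) 1)"
  using assms
proof (induction xs)
  case (Cons x xs)
  then show ?case
    by (simp add: ehat_eq_mult[of "y x" "prod _ _"])
qed simp

lemma derivation_W_prod:
  assumes "derivation_W \<delta>" "\<delta> 1 = 0" "finite I" "\<And>i. i \<in> I \<Longrightarrow> \<delta> (v i) = scaleW (c i) 1"
  shows "\<delta> (\<Prod>i\<in>I. v i) = (\<Sum>i\<in>I. scaleW (c i) (\<Prod>k\<in>I - {i}. v k))"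
  using assms(3,4)
proof (induction I rule: finite_induct)
  case empty
  then show ?case
    using assms(2) by simp
next
  case (insert a I)
  have leibniz: "\<delta> (\<xi> * \<psi>) = \<delta> \<xi> * \<psi> + \<xi> * \<delta> \<psi>" for \<xi> \<psi>
    using assms(1) by (simp add: derivation_W_def)
  have "v a * scaleW (c i) (\<Prod>k\<in>I - {i}. v k) = scaleW (c i) (\<Prod>k\<in>insert a I - {i}. v k)"
    if "i \<in> I" for i
  proof -
    have "insert a I - {i} = insert a (I - {i})"
      using insert.hyps that by auto
    with insert.hyps show ?thesis
      by (metis Diff_iff finite_Diff mult.commute prod.insert scaleW_mult)
  qed
  moreover have "insert a I - {a} = I"
    using insert.hyps by auto
  ultimately show ?case
    using insert by (simp add: leibniz sum_distrib_left flip: scaleW_mult)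
qed

lemma ihat_derivation:
  assumes "cmod (coord z) \<ge> 1"
  shows "derivation_W (ihat z)" "ihat z 1 = 0" "ihat z (emb a) = scaleW (- coeff a (coord z)) 1"
  using contraction[OF linear_coeff[OF assms]] by (simp_all add: ihat_def)

lemma ihat_ehat_one:
  assumes "cmod (coord z) \<ge> 1" "y \<in> discD"
  shows "ihat z (ehat y 1) = scaleW (1 / (coord z - coord y)\<^sup>2) 1"
proof -
  have "cmod (coord y) < 1"
    using assms(2) by (auto simp: discD_def)
  then have "(\<lambda>w. - 1 / (w - coord y)\<^sup>2) \<in> K_forms"
    using dipole_coeff_in_K_forms[of "coord y" 0] by (simp add: dipole_coeff_0[abs_def])
  then show ?thesis
    using ihat_derivation(3)[OF assms(1)] by (simp add: ehat_def Abs_kform_inverse)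
qed

section \<open>Expansion of the form along one factor\<close>

lemma is_W_form_sesquilinear:
  assumes "is_W_form B"
  shows "Vector_Spaces.linear scaleW (*) (B \<xi>)" "B \<psi> \<xi> = cnj (B \<xi> \<psi>)"
  using assms unfolding is_W_form_def hermitian_form_def by blast+

lemma form_sum_scale_left:
  assumes "is_W_form B"
  shows "B (\<Sum>i\<in>I. scaleW (c i) (v i)) \<psi> = (\<Sum>i\<in>I. cnj (c i) * B (v i) \<psi>)"
proof -
  interpret Vector_Spaces.linear scaleW "(*)" "B \<psi>"
    by (rule is_W_form_sesquilinear(1)[OF assms])
  have "B (\<Sum>i\<in>I. scaleW (c i) (v i)) \<psi> = cnj (B \<psi> (\<Sum>i\<in>I. scaleW (c i) (v i)))"
    by (rule is_W_form_sesquilinear(2)[OF assms])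
  also have "\<dots> = (\<Sum>i\<in>I. cnj (c i) * cnj (B \<psi> (v i)))"
    by (simp add: sum scale)
  also have "\<dots> = (\<Sum>i\<in>I. cnj (c i) * B (v i) \<psi>)"
    by (simp flip: is_W_form_sesquilinear(2)[OF assms])
  finally show ?thesis .
qed

text \<open>At \<open>u = coord z \<noteq> 0\<close> the derivation \<open>ihat\<close> at the reflected point \<open>1 / cnj u\<close> takes the
  factor of \<open>y i\<close> to the conjugate of \<open>u\<^sup>2 / (1 - u * cnj (coord (y i)))\<^sup>2\<close>; the square of \<open>u\<close>
  cancels the one in the adjunction.\<close>

lemma form_contract_nonzero:
  assumes B: "is_W_form B" and z: "z \<in> discD" "coord z \<noteq> 0"
    and I: "finite I" "\<And>i. i \<in> I \<Longrightarrow> y i \<in> discD"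
  shows "B (\<Prod>i\<in>I. ehat (y i) 1) (ehat z \<psi>) =
    (\<Sum>i\<in>I. 1 / (1 - coord z * cnj (coord (y i)))\<^sup>2 * B (\<Prod>k\<in>I - {i}. ehat (y k) 1) \<psi>)"
proof -
  let ?u = "coord z" and ?v = "\<lambda>i. ehat (y i) 1"
  have u: "coord (Cinv z) = 1 / cnj ?u" "cmod (coord (Cinv z)) \<ge> 1"
    using z by (auto simp: discD_def norm_divide divide_simps)
  let ?c = "\<lambda>i. 1 / (1 / cnj ?u - coord (y i))\<^sup>2"
  have "ihat (Cinv z) (\<Prod>i\<in>I. ?v i) = (\<Sum>i\<in>I. scaleW (?c i) (\<Prod>k\<in>I - {i}. ?v k))"
    by (intro derivation_W_prod ihat_derivation u I) (simp add: ihat_ehat_one[OF u(2) I(2)] u(1))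
  moreover have "?u\<^sup>2 * B (\<Prod>i\<in>I. ?v i) (ehat z \<psi>) = B (ihat (Cinv z) (\<Prod>i\<in>I. ?v i)) \<psi>"
    using B z by (simp add: is_W_form_def)
  ultimately have "?u\<^sup>2 * B (\<Prod>i\<in>I. ?v i) (ehat z \<psi>)
      = (\<Sum>i\<in>I. cnj (?c i) * B (\<Prod>k\<in>I - {i}. ?v k) \<psi>)"
    by (simp only: form_sum_scale_left[OF B])
  moreover have "cnj (?c i) = ?u\<^sup>2 * (1 / (1 - ?u * cnj (coord (y i)))\<^sup>2)" for i
  proof -
    have "1 / ?u - cnj (coord (y i)) = (1 - ?u * cnj (coord (y i))) / ?u"
      using z(2) by (simp add: field_simps)
    then show ?thesis
      by (simp add: power_divide)
  qed
  ultimately have "?u\<^sup>2 * B (\<Prod>i\<in>I. ?v i) (ehat z \<psi>) = ?u\<^sup>2 *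
      (\<Sum>i\<in>I. 1 / (1 - ?u * cnj (coord (y i)))\<^sup>2 * B (\<Prod>k\<in>I - {i}. ?v k) \<psi>)"
    by (simp only: sum_distrib_left mult.assoc)
  then show ?thesis
    using z(2) by simp
qed

lemma form_contract:
  assumes B: "is_W_form B" and z: "z \<in> discD"
    and I: "finite I" "\<And>i. i \<in> I \<Longrightarrow> y i \<in> discD"
  shows "B (\<Prod>i\<in>I. ehat (y i) 1) (ehat z \<psi>) =
    (\<Sum>i\<in>I. 1 / (1 - coord z * cnj (coord (y i)))\<^sup>2 * B (\<Prod>k\<in>I - {i}. ehat (y k) 1) \<psi>)"
proof (cases "coord z = 0")
  case False
  then show ?thesis
    by (intro form_contract_nonzero assms)
next
  case True
  define f where "f \<zeta> = B (\<Prod>i\<in>I. ehat (y i) 1) (ehat (Pt \<zeta>) \<psi>)" for \<zeta>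
  define g where "g \<zeta> = (\<Sum>i\<in>I. 1 / (1 - \<zeta> * cnj (coord (y i)))\<^sup>2
      * B (\<Prod>k\<in>I - {i}. ehat (y k) 1) \<psi>)" for \<zeta>
  have "f holomorphic_on ball 0 1"
    using B by (simp add: is_W_form_def f_def[abs_def] ball_def)
  then have "isCont f 0"
    by (metis centre_in_ball continuous_on_interior holomorphic_on_imp_continuous_on
        interior_ball zero_less_one)
  then have "f \<midarrow>0\<rightarrow> f 0"
    by (simp add: isCont_def)
  moreover have "g \<midarrow>0\<rightarrow> g 0"
    unfolding g_def by (intro tendsto_intros) auto
  moreover have "eventually (\<lambda>\<zeta>. f \<zeta> = g \<zeta>) (at 0)"
  proof -
    have "eventually (\<lambda>\<zeta>::complex. \<zeta> \<in> ball 0 1 - {0}) (at 0)"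
      by (intro eventually_at_in_open) auto
    then show ?thesis
    proof eventually_elim
      case (elim \<zeta>)
      then show ?case
        using form_contract_nonzero[OF B, of "Pt \<zeta>" I y \<psi>] I by (simp add: f_def g_def)
    qed
  qed
  ultimately have "f 0 = g 0"
    using LIM_unique[of f "f 0" 0 "g 0"] tendsto_cong[of f g "at 0"] by blast
  moreover have "z = Pt 0"
    using z True by (auto simp: discD_def)
  ultimately show ?thesis
    by (simp add: f_def g_def)
qed

section \<open>Summation over bijections\<close>

text \<open>A bijection from \<open>insert a A\<close> is determined by the value at \<open>a\<close> and a bijection from \<open>A\<close>
  onto the remaining set.  Maps are taken extensional, so that each bijection occurs once.\<close>

lemma sum_bij_insert:
  fixes h :: "'a \<Rightarrow> 'b \<Rightarrow> 'c::comm_semiring_1"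
  assumes "finite A" "a \<notin> A" "finite I"
  shows "(\<Sum>f | f \<in> insert a A \<rightarrow>\<^sub>E I \<and> bij_betw f (insert a A) I. \<Prod>j\<in>insert a A. h j (f j)) =
    (\<Sum>i\<in>I. h a i * (\<Sum>f | f \<in> A \<rightarrow>\<^sub>E I - {i} \<and> bij_betw f A (I - {i}). \<Prod>j\<in>A. h j (f j)))"
proof -
  let ?S = "\<lambda>i. {f. f \<in> A \<rightarrow>\<^sub>E I - {i} \<and> bij_betw f A (I - {i})}"
  have fin: "finite (?S i)" for i
    by (rule finite_subset[OF _ finite_PiE[of A "\<lambda>_. I - {i}"]]) (use assms in auto)
  have "(\<Sum>f | f \<in> insert a A \<rightarrow>\<^sub>E I \<and> bij_betw f (insert a A) I. \<Prod>j\<in>insert a A. h j (f j)) =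
      (\<Sum>(i, f)\<in>Sigma I ?S. h a i * (\<Prod>j\<in>A. h j (f j)))"
  proof (rule sum.reindex_bij_witness[of _ "\<lambda>(i, f). f(a := i)" "\<lambda>f. (f a, f(a := undefined))"])
    fix f
    assume f: "f \<in> {f. f \<in> insert a A \<rightarrow>\<^sub>E I \<and> bij_betw f (insert a A) I}"
    then have "f a \<in> I" "f ` A = I - {f a}" "inj_on f A"
      using assms(2) by (auto simp: bij_betw_def inj_on_def)
    then have "bij_betw f A (I - {f a})"
      by (simp add: bij_betw_def)
    moreover have "bij_betw (f(a := undefined)) A (I - {f a}) = bij_betw f A (I - {f a})"
      using assms(2) by (intro bij_betw_cong) auto
    moreover have "f(a := undefined) \<in> A \<rightarrow>\<^sub>E I - {f a}"
      using f \<open>f ` A = I - {f a}\<close> assms(2) by (auto simp: PiE_iff extensional_def)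
    ultimately show "(f a, f(a := undefined)) \<in> Sigma I ?S"
      using \<open>f a \<in> I\<close> by simp
    have "(\<Prod>j\<in>A. h j ((f(a := undefined)) j)) = (\<Prod>j\<in>A. h j (f j))"
      using assms(2) by (intro prod.cong) auto
    then show "(case (f a, f(a := undefined)) of (i, f) \<Rightarrow> h a i * (\<Prod>j\<in>A. h j (f j)))
        = (\<Prod>j\<in>insert a A. h j (f j))"
      using assms by (simp del: fun_upd_apply)
  next
    fix x
    assume "x \<in> Sigma I ?S"
    then obtain i f where x: "x = (i, f)" and i: "i \<in> I"
      and f: "f \<in> A \<rightarrow>\<^sub>E I - {i}" "bij_betw f A (I - {i})"
      by auto
    have "f a = undefined"
      using f(1) assms(2) by (auto simp: PiE_iff extensional_def)
    then show "(\<lambda>f. (f a, f(a := undefined))) (case x of (i, f) \<Rightarrow> f(a := i)) = x"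
      by (simp add: x fun_upd_idem)
    have "bij_betw (f(a := i)) A (I - {i})"
      using bij_betw_cong[of A "f(a := i)" f "I - {i}"] f(2) assms(2) by fastforce
    then have "bij_betw (f(a := i)) (insert a A) (insert i (I - {i}))"
      using assms(2) notIn_Un_bij_betw3[of a A "f(a := i)" "I - {i}"] by simp
    moreover have "f(a := i) \<in> insert a A \<rightarrow>\<^sub>E I"
      using f(1) i by (auto simp: PiE_iff extensional_def)
    ultimately show "(case x of (i, f) \<Rightarrow> f(a := i))
        \<in> {f. f \<in> insert a A \<rightarrow>\<^sub>E I \<and> bij_betw f (insert a A) I}"
      using i by (simp add: x insert_absorb)
  qed auto
  also have "\<dots> = (\<Sum>i\<in>I. \<Sum>f\<in>?S i. h a i * (\<Prod>j\<in>A. h j (f j)))"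
    by (rule sum.Sigma[symmetric]) (use assms fin in auto)
  finally show ?thesis
    by (simp add: sum_distrib_left)
qed

lemma sum_bij_eq_sum_permutes:
  fixes h :: "'a \<Rightarrow> 'a \<Rightarrow> 'b::comm_semiring_1"
  shows "(\<Sum>f | f \<in> A \<rightarrow>\<^sub>E A \<and> bij_betw f A A. \<Prod>j\<in>A. h j (f j)) =
    (\<Sum>\<sigma> | \<sigma> permutes A. \<Prod>j\<in>A. h j (\<sigma> j))"
proof (rule sum.reindex_bij_witness[of _ "\<lambda>\<sigma>. restrict \<sigma> A" "\<lambda>f x. if x \<in> A then f x else x"])
  fix f
  assume "f \<in> {f. f \<in> A \<rightarrow>\<^sub>E A \<and> bij_betw f A A}"
  then have f: "f \<in> A \<rightarrow>\<^sub>E A" "bij_betw f A A"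
    by auto
  from f(1) show "restrict (\<lambda>x. if x \<in> A then f x else x) A = f"
    by (auto simp: fun_eq_iff PiE_iff extensional_def)
  have "bij_betw (\<lambda>x. if x \<in> A then f x else x) A A"
    using f(2) bij_betw_cong[of A "\<lambda>x. if x \<in> A then f x else x" f A] by simp
  then show "(\<lambda>x. if x \<in> A then f x else x) \<in> {\<sigma>. \<sigma> permutes A}"
    by (auto intro: bij_imp_permutes)
  show "(\<Prod>j\<in>A. h j (if j \<in> A then f j else j)) = (\<Prod>j\<in>A. h j (f j))"
    by (intro prod.cong) auto
next
  fix \<sigma>
  assume "\<sigma> \<in> {\<sigma>. \<sigma> permutes A}"
  then have \<sigma>: "\<sigma> permutes A"
    by simp
  then show "(\<lambda>x. if x \<in> A then restrict \<sigma> A x else x) = \<sigma>"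
    by (auto simp: fun_eq_iff permutes_not_in)
  show "restrict \<sigma> A \<in> {f. f \<in> A \<rightarrow>\<^sub>E A \<and> bij_betw f A A}"
    using permutes_imp_bij[OF \<sigma>] permutes_in_image[OF \<sigma>] by auto
qed

text \<open>The induction is on the right factors, while the set of left factors varies: each step
  removes one factor on both sides.  At the end only the vacuum is left on the right; the form of
  a nonempty product with the vacuum vanishes by hermitian symmetry, since the expansion along one
  factor against the vacuum is an empty sum.\<close>

lemma form_eq_sum_bij:
  assumes B: "is_W_form B" and J: "finite J" "\<And>j. j \<in> J \<Longrightarrow> z j \<in> discD"
    and I: "finite I" "\<And>i. i \<in> I \<Longrightarrow> y i \<in> discD"
  shows "B (\<Prod>i\<in>I. ehat (y i) 1) (\<Prod>j\<in>J. ehat (z j) 1) =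
    (\<Sum>f | f \<in> J \<rightarrow>\<^sub>E I \<and> bij_betw f J I.
      \<Prod>j\<in>J. 1 / (1 - coord (z j) * cnj (coord (y (f j))))\<^sup>2)"
  using J I
proof (induction J arbitrary: I rule: finite_induct)
  case empty
  show ?case
  proof (cases "I = {}")
    case True
    have maps: "{f. f \<in> {} \<rightarrow>\<^sub>E {} \<and> bij_betw f {} {}} = {\<lambda>_. undefined}"
      by (auto simp: bij_betw_def)
    have "B 1 1 = 1"
      using B by (simp add: is_W_form_def)
    then show ?thesis
      unfolding True maps by simp
  next
    case False
    then obtain i where i: "i \<in> I"
      by auto
    then have "(\<Prod>i\<in>I. ehat (y i) 1) = ehat (y i) (\<Prod>k\<in>I - {i}. ehat (y k) 1)"
      using empty(2) by (subst ehat_eq_mult) (rule prod.remove)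
    moreover have "B 1 (ehat (y i) \<psi>) = 0" for \<psi>
      using form_contract[OF B, of "y i" "{}" y \<psi>] empty(3)[OF i] by simp
    ultimately have "B (\<Prod>i\<in>I. ehat (y i) 1) 1 = 0"
      using is_W_form_sesquilinear(2)[OF B] by (metis complex_cnj_zero)
    moreover have no_maps: "{f. f \<in> {} \<rightarrow>\<^sub>E I \<and> bij_betw f {} I} = {}"
      using False by (auto simp: bij_betw_def)
    ultimately show ?thesis
      unfolding no_maps by simp
  qed
next
  case (insert a J)
  let ?h = "\<lambda>j i. 1 / (1 - coord (z j) * cnj (coord (y i)))\<^sup>2"
  have "B (\<Prod>i\<in>I. ehat (y i) 1) (\<Prod>j\<in>insert a J. ehat (z j) 1)
      = B (\<Prod>i\<in>I. ehat (y i) 1) (ehat (z a) (\<Prod>j\<in>J. ehat (z j) 1))"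
    using insert.hyps by (simp add: ehat_eq_mult[of "z a" "prod _ _"])
  also have "\<dots> = (\<Sum>i\<in>I. ?h a i *
      B (\<Prod>k\<in>I - {i}. ehat (y k) 1) (\<Prod>j\<in>J. ehat (z j) 1))"
    using insert.prems by (intro form_contract B) auto
  also have "\<dots> = (\<Sum>i\<in>I. ?h a i *
      (\<Sum>f | f \<in> J \<rightarrow>\<^sub>E I - {i} \<and> bij_betw f J (I - {i}). \<Prod>j\<in>J. ?h j (f j)))"
  proof (intro sum.cong refl arg_cong2[of _ _ _ _ "(*)"])
    fix i
    assume "i \<in> I"
    show "B (\<Prod>k\<in>I - {i}. ehat (y k) 1) (\<Prod>j\<in>J. ehat (z j) 1) =
        (\<Sum>f | f \<in> J \<rightarrow>\<^sub>E I - {i} \<and> bij_betw f J (I - {i}). \<Prod>j\<in>J. ?h j (f j))"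
      using insert.prems by (intro insert.IH) auto
  qed
  also have "\<dots> = (\<Sum>f | f \<in> insert a J \<rightarrow>\<^sub>E I \<and> bij_betw f (insert a J) I.
      \<Prod>j\<in>insert a J. ?h j (f j))"
    using insert.hyps insert.prems by (intro sum_bij_insert[symmetric]) auto
  finally show ?case .
qed

theorem proposition7p9:
  fixes B :: "W_space \<Rightarrow> W_space \<Rightarrow> complex"
    and y z :: "nat \<Rightarrow> proj_line"
    and l m :: nat
  assumes "is_W_form B"
    and "\<forall>i\<in>{1..l}. y i \<in> discD" and "inj_on y {1..l}"
    and "\<forall>j\<in>{1..m}. z j \<in> discD" and "inj_on z {1..m}"
  shows "B (foldr (\<lambda>i. ehat (y i)) [1..<Suc l] 1) (foldr (\<lambda>j. ehat (z j)) [1..<Suc m] 1) =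
    (if l \<noteq> m then 0
     else \<Sum>\<sigma> | \<sigma> permutes {1..l}.
            \<Prod>j=1..l. 1 / (1 - coord (z j) * cnj (coord (y (\<sigma> j))))\<^sup>2)"
proof -
  let ?h = "\<lambda>j i. 1 / (1 - coord (z j) * cnj (coord (y i)))\<^sup>2"
  have set_upt: "set [1..<Suc n] = {1..n}" for n
    by auto
  have "B (foldr (\<lambda>i. ehat (y i)) [1..<Suc l] 1) (foldr (\<lambda>j. ehat (z j)) [1..<Suc m] 1)
      = B (\<Prod>i\<in>{1..l}. ehat (y i) 1) (\<Prod>j\<in>{1..m}. ehat (z j) 1)"
    by (simp only: foldr_ehat_eq_prod[OF distinct_upt] set_upt)
  also have "\<dots> = (\<Sum>f | f \<in> {1..m} \<rightarrow>\<^sub>E {1..l} \<and> bij_betw f {1..m} {1..l}.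
      \<Prod>j\<in>{1..m}. ?h j (f j))"
    using assms by (intro form_eq_sum_bij) auto
  finally have eq: "B (foldr (\<lambda>i. ehat (y i)) [1..<Suc l] 1) (foldr (\<lambda>j. ehat (z j)) [1..<Suc m] 1)
      = (\<Sum>f | f \<in> {1..m} \<rightarrow>\<^sub>E {1..l} \<and> bij_betw f {1..m} {1..l}. \<Prod>j\<in>{1..m}. ?h j (f j))" .
  show ?thesis
  proof (cases "l = m")
    case True
    then show ?thesis
      unfolding eq using sum_bij_eq_sum_permutes[of ?h "{1..l}"] by simp
  next
    case False
    then have no_maps: "{f. f \<in> {1..m} \<rightarrow>\<^sub>E {1..l} \<and> bij_betw f {1..m} {1..l}} = {}"
      by (auto dest: bij_betw_same_card)
    from False show ?thesis
      unfolding eq no_maps by simp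
  qed
qed

end
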